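(* Let $1<p<\infty$, $0<r_0<1$, $\mathbb{A}=\{z\in\mathbb{C}:r_0<|z|<1\}$, and let $\phi:\mathbb{A}\to\mathbb{A}$ be analytic, with nontangential boundary values $\phi^*$ on $\partial\mathbb{A}$ (defined a.e.). (i) Suppose $|\phi^*|=r_0$ a.e. on $r_0\mathbb{T}$ and $|\phi^*|=1$ a.e. on $\mathbb{T}$. Then the composition operator $C_\phi:f\mapsto f\circ\phi$ is an isometry on $H^p(\mathbb{A})$ if and only if $\phi(z)=cz$ for all $z\in\mathbb{A}$, where $c$ is a constant of unit modulus. (ii) Suppose $|\phi^*|=1$ a.e. on $r_0\mathbb{T}$ and $|\phi^*|=r_0$ a.e. on $\mathbb{T}$. Then $C_\phi$ is an isometry on $H^p(\mathbb{A})$ if and only if $\phi(z)=c\frac{r_0}{z}$ for all $z\in\mathbb{A}$, where $c$ is a constant of unit modulus.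
   Context: $\mathbb{T}$ is the unit circle and $r_0\mathbb{T}$ the circle of radius $r_0$ centred at $0$. $H^p(\mathbb{A})$ is the space of analytic $f$ on $\mathbb{A}$ with $\sup_{r_0<r<1}\frac1{2\pi}\int_0^{2\pi}|f(re^{it})|^p\,dt<\infty$; such $f$ have nontangential limits $\operatorname{tr}f$ a.e. on $\partial\mathbb{A}$ and the space is normed by $\|f\|^p=\frac1{2\pi}\int_0^{2\pi}|\operatorname{tr}f(e^{it})|^p\,dt+\frac1{2\pi}\int_0^{2\pi}|\operatorname{tr}f(r_0e^{it})|^p\,dt$. An isometry is a linear map $T$ with $\|Tx\|=\|x\|$ for all $x$ (not necessarily onto). *)

theory Defs
  imports "HOL-Complex_Analysis.Complex_Analysis"
begin

definition annulus :: "real \<Rightarrow> complex set" where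
  "annulus r0 = {z. r0 < cmod z \<and> cmod z < 1}"

definition nontangential_region :: "complex set \<Rightarrow> real \<Rightarrow> complex \<Rightarrow> complex set" where
  "nontangential_region D \<alpha> \<zeta> = {z \<in> D. dist z \<zeta> < \<alpha> * infdist z (frontier D)}"

text \<open>Apertures are restricted to \<open>\<alpha> > 1\<close>: for \<open>\<alpha> \<le> 1\<close> the region is empty, since
  \<open>infdist z (frontier D) \<le> dist z \<zeta>\<close> for a boundary point \<open>\<zeta>\<close>.\<close>

definition has_nontangential_limit ::
    "complex set \<Rightarrow> (complex \<Rightarrow> complex) \<Rightarrow> complex \<Rightarrow> complex \<Rightarrow> bool" where
  "has_nontangential_limit D f \<zeta> L \<longleftrightarrow>
     (\<forall>\<alpha>>1. (f \<longlongrightarrow> L) (at \<zeta> within nontangential_region D \<alpha> \<zeta>))"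

text \<open>The boundary function is only defined almost everywhere. Where there is no nontangential
  limit it gets the value \<open>0\<close>; in particular, \<open>cmod (boundary_trace D f \<zeta>) = r\<close> with
  \<open>r > 0\<close> entails that the nontangential limit of \<open>f\<close> at \<open>\<zeta>\<close> exists.\<close>

definition boundary_trace :: "complex set \<Rightarrow> (complex \<Rightarrow> complex) \<Rightarrow> complex \<Rightarrow> complex" where
  "boundary_trace D f \<zeta> =
     (if \<exists>L. has_nontangential_limit D f \<zeta> L
      then (THE L. has_nontangential_limit D f \<zeta> L) else 0)"

definition circle_mean :: "real \<Rightarrow> (complex \<Rightarrow> real) \<Rightarrow> real" where
  "circle_mean r g =
     1 / (2 * pi) * (LINT t|lebesgue_on {0..2 * pi}. g (of_real r * cis t))"

text \<open>Elements of the Hardy space are represented by total functions, of which only the values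
  on the annulus matter.\<close>

definition hardy_space :: "real \<Rightarrow> real \<Rightarrow> (complex \<Rightarrow> complex) set" where
  "hardy_space p r0 =
     {f. f holomorphic_on annulus r0 \<and>
         bdd_above ((\<lambda>r. circle_mean r (\<lambda>z. cmod (f z) powr p)) ` {r0<..<1})}"

definition hardy_norm :: "real \<Rightarrow> real \<Rightarrow> (complex \<Rightarrow> complex) \<Rightarrow> real" where
  "hardy_norm p r0 f =
     (circle_mean 1 (\<lambda>\<zeta>. cmod (boundary_trace (annulus r0) f \<zeta>) powr p) +
      circle_mean r0 (\<lambda>\<zeta>. cmod (boundary_trace (annulus r0) f \<zeta>) powr p)) powr (1 / p)"

text \<open>Linearity is required as an identity of functions on the annulus. Isometries need not be
  surjective.\<close>

definition hardy_isometry ::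
    "real \<Rightarrow> real \<Rightarrow> ((complex \<Rightarrow> complex) \<Rightarrow> (complex \<Rightarrow> complex)) \<Rightarrow> bool" where
  "hardy_isometry p r0 T \<longleftrightarrow>
     (\<forall>f\<in>hardy_space p r0. T f \<in> hardy_space p r0) \<and>
     (\<forall>f\<in>hardy_space p r0. \<forall>g\<in>hardy_space p r0. \<forall>z\<in>annulus r0.
        T (\<lambda>w. f w + g w) z = T f z + T g z) \<and>
     (\<forall>c. \<forall>f\<in>hardy_space p r0. \<forall>z\<in>annulus r0. T (\<lambda>w. c * f w) z = c * T f z) \<and>
     (\<forall>f\<in>hardy_space p r0. hardy_norm p r0 (T f) = hardy_norm p r0 f)"

definition composition_operator ::
    "(complex \<Rightarrow> complex) \<Rightarrow> (complex \<Rightarrow> complex) \<Rightarrow> (complex \<Rightarrow> complex)" where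
  "composition_operator \<phi> f = f \<circ> \<phi>"

end

theory Submission
  imports Defs
begin

text \<open>
  The boundary condition determines \<open>\<phi>\<close> up to a unimodular constant. Put \<open>h = \<phi> / g\<close>, where
  \<open>g z = z\<close> in the first case and \<open>g z = r0 / z\<close> in the second. Then \<open>h\<close> is holomorphic and bounded
  above and away from zero on the annulus, and \<open>|h|\<close> tends to \<open>1\<close> along almost every radius at both
  boundary circles. Classically, \<open>ln |h|\<close> is then a bounded harmonic function with boundary values
  zero, so it vanishes. The argument below replaces harmonic measure by circle means: the
  mean of \<open>|h|\<close> over a circle is at most the larger of its means over two circles on either side
  (\<open>circle_mean_le_max\<close>), and by dominated convergence these tend to \<open>1\<close> at the boundary. So the
  means of \<open>|h|\<close>, and likewise those of \<open>1 / |h|\<close>, are at most \<open>1\<close>. Comparison with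
  \<open>|h| + 1 / |h| \<ge> 2\<close> forces \<open>|h| = 1\<close>, and \<open>h\<close> is constant
  (\<open>unimodular_constant_of_radial_limits\<close>, \<open>self_map_eq_of_boundary_modulus\<close>).

  Conversely, rotations \<open>c z\<close> and inversions \<open>c r0 / z\<close> map the closed annulus onto itself and
  change distances by bounded factors. They therefore carry nontangential limits to nontangential
  limits (\<open>boundary_trace_compose\<close>). They also carry circle means to circle means, of the same or of
  the exchanged radii, and so preserve the Hardy norm (\<open>hardy_isometry_composition_operator\<close>).
\<close>

section \<open>Circle means\<close>

lemma circle_mean_cong:
  assumes "\<And>z. cmod z = \<bar>r\<bar> \<Longrightarrow> g z = g' z"
  shows "circle_mean r g = circle_mean r g'"
proof -
  have "(\<lambda>t. g (of_real r * cis t)) = (\<lambda>t. g' (of_real r * cis t))"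
    using assms by (auto simp: norm_mult)
  then show ?thesis
    by (simp add: circle_mean_def)
qed

text \<open>
  For nonnegative integrands gauge integrability and Lebesgue integrability coincide, and both
  integrals take the value \<open>0\<close> on non-integrable functions. The identity therefore covers the
  integrands of the Hardy norm, which are boundary traces of unknown measurability, and gives access
  to translation and reflection of the gauge integral.
\<close>

lemma circle_mean_eq_integral:
  assumes "\<And>z. 0 \<le> g z"
  shows "circle_mean r g = 1 / (2 * pi) * integral {0..2*pi} (\<lambda>t. g (of_real r * cis t))"
proof -
  let ?F = "\<lambda>t. g (of_real r * cis t)"
  have "(LINT t|lebesgue_on {0..2*pi}. ?F t) = integral {0..2*pi} ?F"
  proof (cases "?F integrable_on {0..2*pi}")
    case True
    then have "?F absolutely_integrable_on {0..2*pi}"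
      using assms by (intro nonnegative_absolutely_integrable_1) auto
    then have "integrable (lebesgue_on {0..2*pi}) ?F"
      by (simp add: integrable_restrict_space set_integrable_def)
    then show ?thesis
      by (simp add: lebesgue_integral_eq_integral)
  next
    case False
    then have "\<not> integrable (lebesgue_on {0..2*pi}) ?F"
      by (metis integrable_on_lebesgue_on lmeasurable_cbox fmeasurableD interval_cbox)
    with False show ?thesis
      by (metis not_integrable_integral_eq not_integrable_integral)
  qed
  then show ?thesis
    by (simp add: circle_mean_def)
qed

lemma has_integral_periodic_shift:
  fixes F :: "real \<Rightarrow> real"
  assumes per: "\<And>t. F (t + T) = F t" and a: "0 \<le> a" "a \<le> T"
    and F: "(F has_integral I) {0..T}"
  shows "((\<lambda>t. F (t + a)) has_integral I) {0..T}"
proof -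
  have int: "F integrable_on {0..a}" "F integrable_on {a..T}"
    using integrable_on_subinterval[OF has_integral_integrable[OF F]] a by auto
  define I1 where "I1 = integral {0..a} F"
  define I2 where "I2 = integral {a..T} F"
  have I12: "(F has_integral I1) {0..a}" "(F has_integral I2) {a..T}"
    using int by (auto simp: I1_def I2_def)
  have "I = I1 + I2"
    using has_integral_combine[OF a I12] F has_integral_unique by blast
  have "((\<lambda>t. F (t + a)) has_integral I2) {0..T - a}"
    using has_integral_shift_Icc_real[of F a I2 0 "T - a"] I12(2)
    by (simp add: o_def add.commute)
  moreover have "((\<lambda>t. F (t + (a - T))) has_integral I1) {T - a..T}"
    using has_integral_shift_Icc_real[of F "a - T" I1 "T - a" T] I12(1)
    by (simp add: o_def add.commute)
  then have "((\<lambda>t. F (t + a)) has_integral I1) {T - a..T}"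
    using per[of "_ + (a - T)"] by (simp add: algebra_simps)
  ultimately have "((\<lambda>t. F (t + a)) has_integral (I2 + I1)) {0..T}"
    using a by (intro has_integral_combine[of 0 "T - a"]) auto
  then show ?thesis
    using \<open>I = I1 + I2\<close> by (simp add: add.commute)
qed

text \<open>
  Shifting by \<open>T - a\<close> undoes the shift by \<open>a\<close>, so integrability is transferred in both directions
  and the identity of the integrals holds for arbitrary periodic functions.
\<close>

lemma integral_periodic_shift:
  fixes F :: "real \<Rightarrow> real"
  assumes per: "\<And>t. F (t + T) = F t" and a: "0 \<le> a" "a \<le> T"
  shows "integral {0..T} (\<lambda>t. F (t + a)) = integral {0..T} F"
proof -
  have "((\<lambda>t. F (t + a)) has_integral I) {0..T} \<longleftrightarrow> (F has_integral I) {0..T}" for I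
  proof
    assume *: "((\<lambda>t. F (t + a)) has_integral I) {0..T}"
    have "((\<lambda>t. F (t + (T - a) + a)) has_integral I) {0..T}"
      by (rule has_integral_periodic_shift[where F = "\<lambda>t. F (t + a)", OF _ _ _ *])
        (use a per[of "_ + a"] in \<open>auto simp: algebra_simps\<close>)
    then show "(F has_integral I) {0..T}"
      using per by simp
  qed (use has_integral_periodic_shift[of F T a I] per a in blast)
  then show ?thesis
    unfolding integral_def integrable_on_def by simp
qed

lemma circle_mean_rotate:
  assumes nonneg: "\<And>z. 0 \<le> g z" and c: "cmod c = 1"
  shows "circle_mean r (\<lambda>z. g (c * z)) = circle_mean r g"
proof -
  define F where "F = (\<lambda>t. g (of_real r * cis t))"
  define a where "a = Arg2pi c"
  have ca: "c = cis a"
    using c Arg2pi_eq[of c] by (simp add: a_def cis_conv_exp)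
  have "F (t + 2 * pi) = F t" for t
    by (simp add: F_def cis_mult[symmetric])
  then have "integral {0..2*pi} (\<lambda>t. F (t + a)) = integral {0..2*pi} F"
    using Arg2pi[of c] by (intro integral_periodic_shift) (auto simp: a_def)
  moreover have "(\<lambda>t. g (c * (of_real r * cis t))) = (\<lambda>t. F (t + a))"
    by (simp add: F_def ca cis_mult[symmetric] mult_ac)
  ultimately show ?thesis
    using nonneg by (simp add: circle_mean_eq_integral F_def)
qed

lemma circle_mean_cnj:
  assumes nonneg: "\<And>z. 0 \<le> g z"
  shows "circle_mean r (\<lambda>z. g (cnj z)) = circle_mean r g"
proof -
  define F where "F = (\<lambda>t. g (of_real r * cis t))"
  have per: "F (2 * pi - t) = F (- t)" for t
    using cis_mult[of "2 * pi" "- t"] by (simp add: F_def)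
  have "integral {0..2*pi} (\<lambda>t. F (- t)) = integral {0..2*pi} ((\<lambda>t. F (- t)) \<circ> (+) (- 2 * pi))"
    by (simp add: o_def per)
  also have "\<dots> = integral {- (2 * pi)..- 0} (\<lambda>t. F (- t))"
    by (subst integral_shift_Icc_real) simp
  also have "\<dots> = integral {0..2*pi} F"
    by (rule Henstock_Kurzweil_Integration.integral_reflect_real)
  finally have "integral {0..2*pi} (\<lambda>t. F (- t)) = integral {0..2*pi} F" .
  moreover have "(\<lambda>t. g (cnj (of_real r * cis t))) = (\<lambda>t. F (- t))"
    by (simp add: F_def cis_cnj)
  ultimately show ?thesis
    using nonneg by (simp add: circle_mean_eq_integral F_def)
qed

text \<open>
  On circles centred at the origin an inversion is complex conjugation followed by a rotation and
  a change of radius.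
\<close>

lemma circle_mean_inversion:
  assumes nonneg: "\<And>z. 0 \<le> g z" and c: "cmod c = 1" and "r \<noteq> 0"
  shows "circle_mean r (\<lambda>z. g (c * (of_real \<rho> / z))) = circle_mean (\<rho> / r) g"
proof -
  have "c * (of_real \<rho> / (of_real r * cis t)) = c * cnj (of_real (\<rho> / r) * cis t)" for t
    using \<open>r \<noteq> 0\<close> by (simp add: cis_cnj cis_inverse[symmetric] field_simps)
  then have "circle_mean r (\<lambda>z. g (c * (of_real \<rho> / z)))
           = circle_mean (\<rho> / r) (\<lambda>z. g (c * cnj z))"
    unfolding circle_mean_def by presburger
  also have "\<dots> = circle_mean (\<rho> / r) (\<lambda>z. g (c * z))"
    using circle_mean_cnj[of "\<lambda>z. g (c * z)"] nonneg by simp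
  also have "\<dots> = circle_mean (\<rho> / r) g"
    using nonneg c by (rule circle_mean_rotate)
  finally show ?thesis .
qed

section \<open>Nontangential limits on the annulus\<close>

lemma open_annulus: "open (annulus r0)"
proof -
  have "annulus r0 = ball 0 1 - cball 0 r0"
    by (auto simp: annulus_def)
  then show ?thesis by (simp add: open_Diff)
qed

lemma frontier_annulus:
  assumes "0 < r0" "r0 < 1"
  shows "frontier (annulus r0) = {z. cmod z = r0 \<or> cmod z = 1}" (is "_ = ?C")
proof -
  have cl: "closure (annulus r0) = {z. r0 \<le> cmod z \<and> cmod z \<le> 1}"
  proof
    have "closed {z::complex. r0 \<le> cmod z \<and> cmod z \<le> 1}"
      by (intro closed_Collect_conj closed_Collect_le continuous_intros)
    then show "closure (annulus r0) \<subseteq> {z. r0 \<le> cmod z \<and> cmod z \<le> 1}"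
      by (intro closure_minimal) (auto simp: annulus_def)
    show "{z. r0 \<le> cmod z \<and> cmod z \<le> 1} \<subseteq> closure (annulus r0)"
    proof clarsimp
      fix z :: complex assume z: "r0 \<le> cmod z" "cmod z \<le> 1"
      define m where "m = (r0 + 1) / 2"
      \<comment> \<open>Approach z along its radius from the midpoint circle.\<close>
      define x where "x n = cmod z + (m - cmod z) / real (n + 2)" for n
      have x: "r0 < x n" "x n < 1" for n
      proof -
        define k where "k = 1 / real (n + 2)"
        have k: "0 < k" "k < 1" by (auto simp: k_def)
        have "x n = cmod z + (m - cmod z) * k"
          by (simp add: x_def k_def)
        then have e: "x n = (1 - k) * cmod z + k * m"
          by (simp add: algebra_simps)
        have "(1 - k) * r0 \<le> (1 - k) * cmod z" "(1 - k) * cmod z \<le> (1 - k) * 1"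
          using z k by (auto intro!: mult_left_mono)
        moreover have "k * r0 < k * m" "k * m < k * 1"
          using k assms by (auto simp: m_def)
        ultimately show "r0 < x n" "x n < 1"
          unfolding e by (auto simp: algebra_simps)
      qed
      have "(\<lambda>n. x n) \<longlonglongrightarrow> cmod z + 0"
        unfolding x_def
        by (intro tendsto_intros LIMSEQ_ignore_initial_segment[OF lim_const_over_n])
      then have "(\<lambda>n. of_real (x n) * sgn z) \<longlonglongrightarrow> of_real (cmod z) * sgn z"
        by (intro tendsto_intros) simp
      moreover have "of_real (cmod z) * sgn z = z"
        by (cases "z = 0") (auto simp: sgn_eq)
      moreover have "of_real (x n) * sgn z \<in> annulus r0" for n
        using x[of n] assms z by (auto simp: annulus_def norm_mult norm_sgn)
      ultimately show "z \<in> closure (annulus r0)"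
        unfolding closure_sequential by force
    qed
  qed
  have "frontier (annulus r0) = closure (annulus r0) - annulus r0"
    by (simp add: frontier_def interior_open open_annulus)
  also have "\<dots> = ?C"
  proof (rule set_eqI)
    fix z
    have "r0 \<le> cmod z \<and> cmod z \<le> 1 \<and> \<not> (r0 < cmod z \<and> cmod z < 1) \<longleftrightarrow> cmod z = r0 \<or> cmod z = 1"
      using assms by linarith
    then show "z \<in> closure (annulus r0) - annulus r0 \<longleftrightarrow> z \<in> ?C"
      unfolding cl by (simp add: annulus_def)
  qed
  finally show ?thesis .
qed

lemma has_nontangential_limit_cong:
  assumes "\<And>z. z \<in> D \<Longrightarrow> f z = g z"
  shows "has_nontangential_limit D f \<zeta> L \<longleftrightarrow> has_nontangential_limit D g \<zeta> L"
proof -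
  have "(f \<longlongrightarrow> L) (at \<zeta> within nontangential_region D \<alpha> \<zeta>) \<longleftrightarrow>
        (g \<longlongrightarrow> L) (at \<zeta> within nontangential_region D \<alpha> \<zeta>)" for \<alpha>
    using assms by (intro tendsto_cong) (auto simp: eventually_at_filter nontangential_region_def)
  then show ?thesis
    by (simp add: has_nontangential_limit_def)
qed

text \<open>
  A map of this kind distorts both the distance to a boundary point and the distance to the boundary
  by at most the factor \<open>K\<close>. It therefore carries approach regions of aperture \<open>\<alpha>\<close> into approach
  regions of aperture \<open>K\<^sup>2 \<alpha>\<close>, which is all that is needed to transport nontangential limits. Only
  distances between a point of \<open>D\<close> and a point of its frontier enter.
\<close>

definition boundary_bilipschitz :: "complex set \<Rightarrow> (complex \<Rightarrow> complex) \<Rightarrow> bool" where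
  "boundary_bilipschitz D \<psi> \<longleftrightarrow>
     \<psi> ` D \<subseteq> D \<and> \<psi> ` frontier D = frontier D \<and>
     (\<exists>K\<ge>1. \<forall>z\<in>D. \<forall>\<eta>\<in>frontier D.
        dist (\<psi> z) (\<psi> \<eta>) \<le> K * dist z \<eta> \<and> dist z \<eta> \<le> K * dist (\<psi> z) (\<psi> \<eta>))"

lemma has_nontangential_limit_compose:
  assumes \<psi>: "boundary_bilipschitz D \<psi>" and \<zeta>: "\<zeta> \<in> frontier D"
    and lim: "has_nontangential_limit D f (\<psi> \<zeta>) L"
  shows "has_nontangential_limit D (f \<circ> \<psi>) \<zeta> L"
  unfolding has_nontangential_limit_def
proof (intro allI impI)
  fix \<alpha> :: real assume \<alpha>: "1 < \<alpha>"
  have maps: "\<psi> ` D \<subseteq> D" "\<psi> ` frontier D = frontier D"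
    using \<psi> by (auto simp: boundary_bilipschitz_def)
  obtain K where K: "1 \<le> K"
    and lip: "\<And>z \<eta>. z \<in> D \<Longrightarrow> \<eta> \<in> frontier D \<Longrightarrow> dist (\<psi> z) (\<psi> \<eta>) \<le> K * dist z \<eta>"
    and colip: "\<And>z \<eta>. z \<in> D \<Longrightarrow> \<eta> \<in> frontier D \<Longrightarrow> dist z \<eta> \<le> K * dist (\<psi> z) (\<psi> \<eta>)"
    using \<psi> unfolding boundary_bilipschitz_def by blast
  \<comment> \<open>One factor \<open>K\<close> pays for the distance to the boundary point, the other for the distance to
    the frontier.\<close>
  define \<beta> where "\<beta> = K * \<alpha> * K"
  have \<beta>: "1 < \<beta>"
    unfolding \<beta>_def using K \<alpha>
    by (metis less_1_mult mult.commute mult_cancel_right1 order_le_less)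
  have inf: "infdist z (frontier D) \<le> K * infdist (\<psi> z) (frontier D)" if "z \<in> D" for z
  proof -
    have "infdist z (frontier D) / K \<le> infdist (\<psi> z) (frontier D)"
    proof -
      have "infdist z (frontier D) / K \<le> dist (\<psi> z) \<eta>" if "\<eta> \<in> frontier D" for \<eta>
      proof -
        obtain \<eta>' where \<eta>': "\<eta>' \<in> frontier D" "\<eta> = \<psi> \<eta>'"
          using maps(2) \<open>\<eta> \<in> frontier D\<close> by blast
        have "infdist z (frontier D) \<le> dist z \<eta>'"
          using \<eta>' by (intro infdist_le)
        also have "\<dots> \<le> K * dist (\<psi> z) \<eta>"
          using colip \<open>z \<in> D\<close> \<eta>' by simp
        finally show ?thesis
          using K by (simp add: field_simps)
      qed
      then show ?thesis
        using \<zeta> by (subst (2) infdist_notempty) (auto intro!: cINF_greatest)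
    qed
    then show ?thesis
      using K by (simp add: field_simps)
  qed
  let ?R = "nontangential_region D"
  have region: "\<psi> z \<in> ?R \<beta> (\<psi> \<zeta>)" if z: "z \<in> ?R \<alpha> \<zeta>" for z
  proof -
    have zD: "z \<in> D" and d: "dist z \<zeta> < \<alpha> * infdist z (frontier D)"
      using z by (auto simp: nontangential_region_def)
    have "dist (\<psi> z) (\<psi> \<zeta>) \<le> K * dist z \<zeta>"
      using lip zD \<zeta> by simp
    also have "\<dots> < K * (\<alpha> * infdist z (frontier D))"
      using d K by simp
    also have "\<dots> \<le> K * (\<alpha> * (K * infdist (\<psi> z) (frontier D)))"
      using inf[OF zD] K \<alpha> by (intro mult_left_mono) auto
    finally show ?thesis
      using maps zD by (auto simp: nontangential_region_def \<beta>_def mult_ac)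
  qed
  have "filterlim \<psi> (at (\<psi> \<zeta>) within ?R \<beta> (\<psi> \<zeta>)) (at \<zeta> within ?R \<alpha> \<zeta>)"
    unfolding filterlim_at
  proof
    have "\<psi> z \<noteq> \<psi> \<zeta>" if "z \<in> ?R \<alpha> \<zeta>" "z \<noteq> \<zeta>" for z
      using colip[of z \<zeta>] that \<zeta> by (auto simp: nontangential_region_def)
    then show "\<forall>\<^sub>F z in at \<zeta> within ?R \<alpha> \<zeta>. \<psi> z \<in> ?R \<beta> (\<psi> \<zeta>) \<and> \<psi> z \<noteq> \<psi> \<zeta>"
      using region by (auto simp: eventually_at_filter)
    have "((\<lambda>z. K * dist z \<zeta>) \<longlongrightarrow> K * dist \<zeta> \<zeta>) (at \<zeta> within ?R \<alpha> \<zeta>)"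
      by (intro tendsto_intros)
    then have *: "((\<lambda>z. K * dist z \<zeta>) \<longlongrightarrow> 0) (at \<zeta> within ?R \<alpha> \<zeta>)"
      by simp
    have "\<forall>\<^sub>F z in at \<zeta> within ?R \<alpha> \<zeta>. norm (dist (\<psi> z) (\<psi> \<zeta>)) \<le> K * dist z \<zeta>"
      using lip \<zeta> by (simp add: eventually_at_filter nontangential_region_def)
    then have "((\<lambda>z. dist (\<psi> z) (\<psi> \<zeta>)) \<longlongrightarrow> 0) (at \<zeta> within ?R \<alpha> \<zeta>)"
      using * by (rule Lim_null_comparison)
    then show "(\<psi> \<longlongrightarrow> \<psi> \<zeta>) (at \<zeta> within ?R \<alpha> \<zeta>)"
      by (rule tendsto_dist_iff[THEN iffD2])
  qed
  moreover have "(f \<longlongrightarrow> L) (at (\<psi> \<zeta>) within ?R \<beta> (\<psi> \<zeta>))"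
    using lim \<beta> by (simp add: has_nontangential_limit_def)
  ultimately have "((\<lambda>z. f (\<psi> z)) \<longlongrightarrow> L) (at \<zeta> within ?R \<alpha> \<zeta>)"
    by (rule filterlim_compose[where g = f and f = \<psi>, rotated])
  then show "((f \<circ> \<psi>) \<longlongrightarrow> L) (at \<zeta> within ?R \<alpha> \<zeta>)"
    by (simp add: o_def)
qed

lemma boundary_trace_compose:
  assumes \<psi>: "boundary_bilipschitz D \<psi>" and \<psi>': "boundary_bilipschitz D \<psi>'"
    and inv: "\<And>z. z \<in> D \<union> frontier D \<Longrightarrow> \<psi>' (\<psi> z) = z" "\<And>z. z \<in> D \<Longrightarrow> \<psi> (\<psi>' z) = z"
    and \<zeta>: "\<zeta> \<in> frontier D"
  shows "boundary_trace D (f \<circ> \<psi>) \<zeta> = boundary_trace D f (\<psi> \<zeta>)"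
proof -
  have "has_nontangential_limit D (f \<circ> \<psi>) \<zeta> L \<longleftrightarrow> has_nontangential_limit D f (\<psi> \<zeta>) L" for L
  proof
    assume "has_nontangential_limit D (f \<circ> \<psi>) \<zeta> L"
    then have "has_nontangential_limit D (f \<circ> \<psi> \<circ> \<psi>') (\<psi> \<zeta>) L"
      using \<psi> \<zeta> inv(1) by (intro has_nontangential_limit_compose[OF \<psi>'])
        (auto simp: boundary_bilipschitz_def)
    then show "has_nontangential_limit D f (\<psi> \<zeta>) L"
      by (rule has_nontangential_limit_cong[THEN iffD1, rotated]) (simp add: inv)
  qed (rule has_nontangential_limit_compose[OF \<psi> \<zeta>])
  then have "has_nontangential_limit D (f \<circ> \<psi>) \<zeta> = has_nontangential_limit D f (\<psi> \<zeta>)"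
    by blast
  then show ?thesis
    by (simp add: boundary_trace_def)
qed

lemma boundary_trace_cong:
  assumes "\<And>z. z \<in> D \<Longrightarrow> f z = g z"
  shows "boundary_trace D f \<zeta> = boundary_trace D g \<zeta>"
proof -
  have "has_nontangential_limit D f \<zeta> = has_nontangential_limit D g \<zeta>"
    using has_nontangential_limit_cong[of D f g] assms by blast
  then show ?thesis
    by (simp add: boundary_trace_def)
qed

section \<open>Radial limits\<close>

text \<open>
  Close to the boundary circle of radius \<open>r\<close> the nearest frontier point to \<open>x \<omega>\<close> is \<open>r \<omega>\<close> itself, so
  radial approach stays inside every approach region; aperture \<open>2\<close> is enough here. The bound
  \<open>(1 - r0) / 2\<close> below keeps \<open>x\<close> on the nearer side of the midpoint between the two circles.
\<close>

lemma has_nontangential_limit_radial: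
  assumes r0: "0 < r0" "r0 < 1" and r: "r = r0 \<or> r = 1" and \<omega>: "cmod \<omega> = 1"
    and lim: "has_nontangential_limit (annulus r0) f (of_real r * \<omega>) L"
    and X: "X \<longlonglongrightarrow> r" "\<And>n. r0 < X n" "\<And>n. X n < 1"
  shows "(\<lambda>n. f (of_real (X n) * \<omega>)) \<longlonglongrightarrow> L"
proof -
  let ?R = "nontangential_region (annulus r0) 2 (of_real r * \<omega>)"
  have dist: "dist (of_real x * \<omega>) (of_real y * \<omega>) = \<bar>x - y\<bar>" for x y :: real
    using \<omega> by (simp add: dist_norm norm_mult flip: left_diff_distrib of_real_diff)
  have region: "of_real x * \<omega> \<in> ?R" if x: "r0 < x" "x < 1" "\<bar>x - r\<bar> < (1 - r0) / 2" for x
  proof -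
    have norm: "cmod (of_real x * \<omega>) = x"
      using \<omega> x r0 by (simp add: norm_mult)
    have "\<bar>x - r\<bar> \<le> infdist (of_real x * \<omega>) (frontier (annulus r0))"
    proof -
      have "\<bar>x - r\<bar> \<le> dist (of_real x * \<omega>) \<eta>" if "cmod \<eta> = r0 \<or> cmod \<eta> = 1" for \<eta>
      proof -
        have "\<bar>x - cmod \<eta>\<bar> \<le> dist (of_real x * \<omega>) \<eta>"
          using norm_triangle_ineq3[of "of_real x * \<omega>" \<eta>] norm by (simp add: dist_norm)
        moreover have "\<bar>x - r\<bar> \<le> \<bar>x - cmod \<eta>\<bar>"
          using that x r r0 by (auto simp: abs_if field_simps split: if_splits)
        ultimately show ?thesis by simp
      qed
      moreover have "frontier (annulus r0) \<noteq> {}"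
        using frontier_annulus[OF r0] norm_one by blast
      ultimately show ?thesis
        using frontier_annulus[OF r0] by (subst infdist_notempty) (auto intro!: cINF_greatest)
    qed
    moreover have "0 < \<bar>x - r\<bar>"
      using x r by auto
    ultimately have "\<bar>x - r\<bar> < 2 * infdist (of_real x * \<omega>) (frontier (annulus r0))"
      by linarith
    then show ?thesis
      using x norm dist by (simp add: nontangential_region_def annulus_def)
  qed
  have "\<forall>\<^sub>F n in sequentially. \<bar>X n - r\<bar> < (1 - r0) / 2"
    using tendstoD[OF X(1), of "(1 - r0) / 2"] r0 by (simp add: dist_real_def)
  then have "\<forall>\<^sub>F n in sequentially. of_real (X n) * \<omega> \<in> ?R \<and> of_real (X n) * \<omega> \<noteq> of_real r * \<omega>"
  proof eventually_elim
    case (elim n)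
    have "X n \<noteq> r"
      using X(2)[of n] X(3)[of n] r by auto
    then show ?case
      using region X(2,3) elim \<omega> by auto
  qed
  moreover have "(\<lambda>n. of_real (X n) * \<omega>) \<longlonglongrightarrow> of_real r * \<omega>"
    by (intro tendsto_intros X)
  ultimately have "filterlim (\<lambda>n. of_real (X n) * \<omega>) (at (of_real r * \<omega>) within ?R) sequentially"
    by (simp add: filterlim_at)
  moreover have "(f \<longlongrightarrow> L) (at (of_real r * \<omega>) within ?R)"
    using lim by (simp add: has_nontangential_limit_def)
  ultimately show ?thesis
    by (rule filterlim_compose[rotated])
qed

text \<open>
  Two nontangential limits at the same point are limits along one radius and hence equal, so the
  definite description in the trace denotes the limit as soon as a limit exists.
\<close>

lemma boundary_trace_radial:
  assumes r0: "0 < r0" "r0 < 1" and r: "r = r0 \<or> r = 1" and \<omega>: "cmod \<omega> = 1"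
    and nz: "boundary_trace (annulus r0) f (of_real r * \<omega>) \<noteq> 0"
    and X: "X \<longlonglongrightarrow> r" "\<And>n. r0 < X n" "\<And>n. X n < 1"
  shows "(\<lambda>n. f (of_real (X n) * \<omega>)) \<longlonglongrightarrow> boundary_trace (annulus r0) f (of_real r * \<omega>)"
proof -
  let ?P = "has_nontangential_limit (annulus r0) f (of_real r * \<omega>)"
  obtain L where L: "?P L"
    using nz unfolding boundary_trace_def by presburger
  have "L' = L" if "?P L'" for L'
    using has_nontangential_limit_radial[OF r0 r \<omega> _ X] that L LIMSEQ_unique by blast
  then have "(THE L. ?P L) = L"
    using the_equality[of ?P L] L by blast
  then have "boundary_trace (annulus r0) f (of_real r * \<omega>) = L"
    using L unfolding boundary_trace_def by metis
  then show ?thesis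
    using has_nontangential_limit_radial[OF r0 r \<omega> L X] by simp
qed

section \<open>Holomorphic functions with unimodular boundary values\<close>

lemma circle_mean_tendsto_1:
  assumes h: "h holomorphic_on annulus r0" and bound: "\<And>z. z \<in> annulus r0 \<Longrightarrow> cmod (h z) \<le> B"
    and X: "\<And>n. r0 < X n" "\<And>n. X n < 1" "0 < r0"
    and lim: "AE t in lebesgue_on {0..2*pi}. (\<lambda>n. cmod (h (of_real (X n) * cis t))) \<longlonglongrightarrow> 1"
  shows "(\<lambda>n. circle_mean (X n) (\<lambda>z. cmod (h z))) \<longlonglongrightarrow> 1"
proof -
  let ?M = "lebesgue_on {0..2*pi}"
  have A: "of_real (X n) * cis t \<in> annulus r0" for n t
    using X(1)[of n] X(2)[of n] X(3) by (simp add: annulus_def norm_mult)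
  have cont: "continuous_on {0..2*pi} (\<lambda>t. cmod (h (of_real (X n) * cis t)))" for n
    using A by (intro continuous_intros continuous_on_compose2[OF holomorphic_on_imp_continuous_on[OF h]]) auto
  have "(\<lambda>n. LINT t|?M. cmod (h (of_real (X n) * cis t))) \<longlonglongrightarrow> (LINT t|?M. 1)"
  proof (rule integral_dominated_convergence[where w = "\<lambda>_. B"])
    show "(\<lambda>t. cmod (h (of_real (X n) * cis t))) \<in> borel_measurable ?M" for n
      using cont by (intro continuous_imp_measurable_on_sets_lebesgue) auto
    show "integrable ?M (\<lambda>_. B)"
      by (intro continuous_imp_integrable_real continuous_intros)
  qed (use lim bound A in auto)
  moreover have "(LINT t|?M. 1) = 2 * pi"
    by (simp add: measure_restrict_space)
  ultimately have "(\<lambda>n. 1 / (2 * pi) * (LINT t|?M. cmod (h (of_real (X n) * cis t)))) \<longlonglongrightarrow> 1 / (2 * pi) * (2 * pi)"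
    by (intro tendsto_intros) simp
  then show ?thesis
    by (simp add: circle_mean_def)
qed

text \<open>
  Means of \<open>|h|\<close> obey the maximum principle. Averaging the rotates of \<open>h\<close> with unimodular weights \<open>u\<close>,
  \<open>H z = \<integral> h (z e^(it)) u t dt\<close>, gives a holomorphic function with
  \<open>|H z| \<le> \<integral> |h (|z| e^(it))| dt\<close>. Choosing \<open>u\<close> to cancel the argument of \<open>h\<close> on the circle of
  radius \<open>s\<close> turns this into an equality at \<open>z = s\<close>, and the maximum modulus principle for \<open>H\<close>
  on a closed annulus yields the claim. Since \<open>h\<close> has no zeros, \<open>u\<close> is continuous.
\<close>

lemma circle_mean_le_max:
  assumes h: "h holomorphic_on annulus r0" and nz: "\<And>z. z \<in> annulus r0 \<Longrightarrow> h z \<noteq> 0"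
    and r: "0 < r0" "r0 < r1" "r1 < s" "s < r2" "r2 < 1"
  shows "circle_mean s (\<lambda>z. cmod (h z))
       \<le> max (circle_mean r1 (\<lambda>z. cmod (h z))) (circle_mean r2 (\<lambda>z. cmod (h z)))"
proof -
  let ?I = "{0..2*pi}"
  define m where "m x = integral ?I (\<lambda>t. cmod (h (of_real x * cis t)))" for x
  have mean: "circle_mean x (\<lambda>z. cmod (h z)) = 1 / (2 * pi) * m x" for x
    by (simp add: circle_mean_eq_integral m_def)
  define u where "u t = cnj (sgn (h (of_real s * cis t)))" for t
  define H where "H z = integral ?I (\<lambda>t. h (z * cis t) * u t)" for z
  have A: "z * cis t \<in> annulus r0" if "z \<in> annulus r0" for z t
    using that by (simp add: annulus_def norm_mult)
  have sA: "of_real s \<in> annulus r0"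
    using r by (simp add: annulus_def)
  have conth: "continuous_on S (\<lambda>x. h (f x))" if "continuous_on S f" "f ` S \<subseteq> annulus r0"
    for S and f :: "'x::topological_space \<Rightarrow> complex"
    using that by (intro continuous_on_compose2[OF holomorphic_on_imp_continuous_on[OF h]])
  have contu: "continuous_on S u" for S
    unfolding u_def using A[OF sA] nz by (intro continuous_intros conth) auto
  have normu: "cmod (u t) = 1" for t
    using nz[OF A[OF sA]] by (simp add: u_def norm_sgn)
  have cont_int: "continuous_on ?I (\<lambda>t. h (z * cis t) * u t)" 
    "continuous_on ?I (\<lambda>t. cmod (h (z * cis t)))" if "z \<in> annulus r0" for z
    using A[OF that] by (auto intro!: continuous_intros conth contu)

  have "H field_differentiable at z" if z: "z \<in> annulus r0" for z
  proof -
    obtain e where e: "e > 0" "ball z e \<subseteq> annulus r0"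
      using open_annulus z by (meson open_contains_ball)
    have "(\<lambda>z. integral (cbox 0 (2*pi)) (\<lambda>t. h (z * cis t) * u t)) holomorphic_on ball z e"
    proof (rule leibniz_rule_holomorphic[where fx = "\<lambda>z t. deriv h (z * cis t) * cis t * u t"])
      fix w t assume w: "w \<in> ball z e"
      then have wA: "w * cis t \<in> annulus r0"
        using e A by blast
      have "(h has_field_derivative deriv h (w * cis t)) (at (w * cis t))"
        using h open_annulus wA by (rule holomorphic_derivI)
      then have "((\<lambda>w. h (w * cis t)) has_field_derivative deriv h (w * cis t) * cis t) (at w)"
        by (rule DERIV_chain2) (auto intro!: derivative_eq_intros)
      then show "((\<lambda>w. h (w * cis t) * u t) has_field_derivative deriv h (w * cis t) * cis t * u t)
          (at w within ball z e)"
        by (intro DERIV_cmult_right) (rule has_field_derivative_at_within)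
    next
      fix w assume "w \<in> ball z e"
      then show "(\<lambda>t. h (w * cis t) * u t) integrable_on cbox 0 (2*pi)"
        using cont_int(1)[of w] e by (auto intro!: integrable_continuous_real)
    next
      have hd: "continuous_on (annulus r0) (deriv h)"
        using holomorphic_deriv[OF h open_annulus] holomorphic_on_imp_continuous_on by blast
      have "continuous_on (ball z e \<times> cbox 0 (2*pi)) (\<lambda>x. deriv h (fst x * cis (snd x)) * cis (snd x) * u (snd x))"
        using e A
        by (intro continuous_intros continuous_on_compose2[OF hd] continuous_on_compose2[OF contu[of UNIV]])
          auto
      then show "continuous_on (ball z e \<times> cbox 0 (2*pi)) (\<lambda>(x, t). deriv h (x * cis t) * cis t * u t)"
        by (simp add: case_prod_beta)
    qed simp
    then have "H holomorphic_on ball z e"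
      by (simp add: H_def[abs_def])
    then show ?thesis
      using e by (auto intro: holomorphic_on_imp_differentiable_at)
  qed
  then have hol: "H holomorphic_on annulus r0"
    by (auto simp: holomorphic_on_def intro: field_differentiable_at_within)
  have H_le: "cmod (H z) \<le> m (cmod z)" if z: "z \<in> annulus r0" for z
  proof -
    have "cmod (H z) \<le> integral ?I (\<lambda>t. cmod (h (z * cis t)))"
      unfolding H_def using cont_int[OF z]
      by (intro integral_norm_bound_integral) (auto intro!: integrable_continuous_real simp: norm_mult normu)
    \<comment> \<open>Rotate \<open>z\<close> onto the positive real axis.\<close>
    also have "(\<lambda>t. cmod (h (z * cis t))) = (\<lambda>t. cmod (h (sgn z * (of_real (cmod z) * cis t))))"
      by (cases "z = 0") (auto simp: sgn_eq)
    also have "integral ?I \<dots> = m (cmod z)"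
    proof -
      have "z \<noteq> 0"
        using z r by (auto simp: annulus_def)
      then show ?thesis
        using circle_mean_rotate[of "\<lambda>z. cmod (h z)" "sgn z" "cmod z"]
        by (simp add: circle_mean_eq_integral m_def norm_sgn)
    qed
    finally show ?thesis .
  qed
  have "cmod (H (of_real s)) \<le> max (m r1) (m r2)"
  proof -
    let ?S = "{z. r1 \<le> cmod z \<and> cmod z \<le> r2}"
    have S: "?S \<subseteq> annulus r0"
      using r by (auto simp: annulus_def)
    have clS: "closed ?S"
      by (intro closed_Collect_conj closed_Collect_le continuous_intros)
    have opS: "open {z::complex. r1 < cmod z \<and> cmod z < r2}"
      by (intro open_Collect_conj open_Collect_less continuous_intros)
    show ?thesis
    proof (rule maximum_modulus_frontier[of H ?S])
      show "H holomorphic_on interior ?S"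
        using hol S interior_subset by (meson holomorphic_on_subset order_trans)
      show "continuous_on (closure ?S) H"
        using hol S clS by (simp add: closure_closed)
          (meson holomorphic_on_imp_continuous_on continuous_on_subset)
      show "bounded ?S"
        by (rule bounded_subset[of "cball 0 r2"]) auto
      show "of_real s \<in> ?S"
        using r by auto
      fix z assume z: "z \<in> frontier ?S"
      have "{z. r1 < cmod z \<and> cmod z < r2} \<subseteq> interior ?S"
        by (rule interior_maximal[OF _ opS]) auto
      with z clS have "z \<in> ?S" "\<not> (r1 < cmod z \<and> cmod z < r2)"
        by (auto simp: frontier_def)
      then have "cmod z = r1 \<or> cmod z = r2"
        by auto
      then show "cmod (H z) \<le> max (m r1) (m r2)"
        using H_le[of z] S \<open>z \<in> ?S\<close> by auto
    qed
  qed
  moreover have "H (of_real s) = of_real (m s)"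
  proof -
    have "h (of_real s * cis t) * u t = of_real (cmod (h (of_real s * cis t)))" for t
      unfolding u_def sgn_eq
      using nz[OF A[OF sA, of t]] complex_norm_square[of "h (of_real s * cis t)"]
      by (simp add: field_simps power2_eq_square)
    then have "H (of_real s) = integral ?I (of_real \<circ> (\<lambda>t. cmod (h (of_real s * cis t))))"
      by (simp add: H_def o_def)
    also have "\<dots> = of_real (m s)"
      unfolding m_def using cont_int(2)[OF sA]
      by (intro integral_linear integrable_continuous_real bounded_linear_of_real)
    finally show ?thesis .
  qed
  ultimately have "m s \<le> max (m r1) (m r2)"
    by (auto simp: abs_if split: if_splits)
  then show ?thesis
    by (auto simp: mean max_def divide_simps split: if_splits)
qed

text \<open>
  The two comparison circles of the maximum principle for means are pushed out to the boundary
  along \<open>X r\<close>, a sequence of radii between \<open>s\<close> and \<open>r\<close> that converges to \<open>r\<close>.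
\<close>

lemma circle_mean_le_1:
  assumes h: "h holomorphic_on annulus r0" and nz: "\<And>z. z \<in> annulus r0 \<Longrightarrow> h z \<noteq> 0"
    and bound: "\<And>z. z \<in> annulus r0 \<Longrightarrow> cmod (h z) \<le> B" and r0: "0 < r0" "r0 < s" "s < 1"
    and lim: "\<And>X r. r = r0 \<or> r = 1 \<Longrightarrow> X \<longlonglongrightarrow> r \<Longrightarrow> (\<And>n. r0 < X n) \<Longrightarrow> (\<And>n. X n < 1) \<Longrightarrow>
      AE t in lebesgue_on {0..2*pi}. (\<lambda>n. cmod (h (of_real (X n) * cis t))) \<longlonglongrightarrow> 1"
  shows "circle_mean s (\<lambda>z. cmod (h z)) \<le> 1"
proof -
  define X where "X r n = r + (s - r) / real (n + 2)" for r n
  have Xlim: "X r \<longlonglongrightarrow> r" for r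
  proof -
    have "X r \<longlonglongrightarrow> r + 0"
      unfolding X_def by (intro tendsto_intros LIMSEQ_ignore_initial_segment[OF lim_const_over_n])
    then show ?thesis by simp
  qed
  have frac: "0 < d / real (n + 2)" "d / real (n + 2) < d" if "0 < d" for d :: real and n
    using that divide_strict_left_mono[of 1 "real (n + 2)" d] by simp_all
  have X0: "r0 < X r0 n" "X r0 n < s" for n
    using frac[of "s - r0" n] r0 by (auto simp: X_def)
  have X1: "s < X 1 n" "X 1 n < 1" for n
    using frac[of "1 - s" n] r0 by (auto simp: X_def minus_divide_left[symmetric] diff_divide_distrib)
  have X: "r0 < X r n" "X r n < 1" if "r = r0 \<or> r = 1" for r n
    using that X0[of n] X1[of n] r0 by auto
  let ?m = "\<lambda>x. circle_mean x (\<lambda>z. cmod (h z))"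
  have m: "(\<lambda>n. ?m (X r n)) \<longlonglongrightarrow> 1" if r: "r = r0 \<or> r = 1" for r
    using X[OF r] r0(1) lim[OF r Xlim X[OF r]] by (intro circle_mean_tendsto_1[OF h bound])
  have "(\<lambda>n. max (?m (X r0 n)) (?m (X 1 n))) \<longlonglongrightarrow> max 1 1"
    by (intro tendsto_max m) auto
  moreover have "?m s \<le> max (?m (X r0 n)) (?m (X 1 n))" for n
    using X0[of n] X1[of n] r0 by (intro circle_mean_le_max[OF h nz]) auto
  ultimately have "?m s \<le> max 1 1"
    by (intro LIMSEQ_le_const) auto
  then show ?thesis by simp
qed

text \<open>
  Both \<open>h\<close> and \<open>1 / h\<close> are bounded with unimodular boundary values, so the means of \<open>|h|\<close> and of
  \<open>1 / |h|\<close> over each circle are at most \<open>1\<close>. But \<open>|h| + 1 / |h| \<ge> 2\<close> pointwise, with equality only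
  for \<open>|h| = 1\<close>. Hence \<open>|h| = 1\<close> throughout, and a holomorphic function of constant modulus on a
  connected open set is constant.
\<close>

lemma unimodular_constant_of_radial_limits:
  assumes h: "h holomorphic_on annulus r0" and r0: "0 < r0" "r0 < 1"
    and bound: "\<And>z. z \<in> annulus r0 \<Longrightarrow> a \<le> cmod (h z)" "\<And>z. z \<in> annulus r0 \<Longrightarrow> cmod (h z) \<le> b" "0 < a"
    and lim: "\<And>X r. r = r0 \<or> r = 1 \<Longrightarrow> X \<longlonglongrightarrow> r \<Longrightarrow> (\<And>n. r0 < X n) \<Longrightarrow> (\<And>n. X n < 1) \<Longrightarrow>
      AE t in lebesgue_on {0..2*pi}. (\<lambda>n. cmod (h (of_real (X n) * cis t))) \<longlonglongrightarrow> 1"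
  shows "\<exists>c. cmod c = 1 \<and> (\<forall>z\<in>annulus r0. h z = c)"
proof -
  have nz: "h z \<noteq> 0" if "z \<in> annulus r0" for z
    using bound(1)[OF that] bound(3) by auto
  have norm1: "cmod (h z) = 1" if z: "z \<in> annulus r0" for z
  proof -
    define s where "s = cmod z"
    have s: "r0 < s" "s < 1"
      using z by (auto simp: s_def annulus_def)
    let ?I = "{0..2*pi}"
    have A: "of_real s * cis t \<in> annulus r0" for t
      using s r0 by (simp add: annulus_def norm_mult)
    define k where "k t = cmod (h (of_real s * cis t))" for t
    have kpos: "0 < k t" for t
      using nz[OF A] by (simp add: k_def)
    have contk: "continuous_on ?I k"
      unfolding k_def using A
      by (intro continuous_intros continuous_on_compose2[OF holomorphic_on_imp_continuous_on[OF h]]) auto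
    have contk': "continuous_on ?I (\<lambda>t. 1 / k t)"
      using kpos by (intro continuous_intros contk) (metis less_irrefl)
    have "circle_mean s (\<lambda>z. cmod (h z)) \<le> 1"
      using s r0 by (intro circle_mean_le_1[OF h nz bound(2)] lim) auto
    then have k1: "integral ?I k \<le> 2 * pi"
      by (simp add: circle_mean_eq_integral k_def[abs_def])
    have "circle_mean s (\<lambda>z. cmod (1 / h z)) \<le> 1"
    proof (rule circle_mean_le_1)
      show "(\<lambda>z. 1 / h z) holomorphic_on annulus r0"
        using nz by (intro holomorphic_intros h) auto
      show "cmod (1 / h z) \<le> 1 / a" if "z \<in> annulus r0" for z
        using bound(1)[OF that] bound(3) by (simp add: norm_divide frac_le)
      fix X :: "nat \<Rightarrow> real" and r
      assume "r = r0 \<or> r = 1" "X \<longlonglongrightarrow> r" "\<And>n. r0 < X n" "\<And>n. X n < 1"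
      from lim[OF this]
      show "AE t in lebesgue_on ?I. (\<lambda>n. cmod (1 / h (of_real (X n) * cis t))) \<longlonglongrightarrow> 1"
      proof eventually_elim
        case (elim t)
        have "(\<lambda>n. 1 / cmod (h (of_real (X n) * cis t))) \<longlonglongrightarrow> 1 / 1"
          by (intro tendsto_intros elim) auto
        then show ?case
          by (simp add: norm_divide)
      qed
    qed (use nz s r0 in auto)
    then have k2: "integral ?I (\<lambda>t. 1 / k t) \<le> 2 * pi"
      by (simp add: circle_mean_eq_integral k_def[abs_def] norm_divide)
    have nonneg: "0 \<le> k t + 1 / k t - 2" for t
    proof -
      have "k t + 1 / k t - 2 = (k t - 1)\<^sup>2 / k t"
        using kpos[of t] by (simp add: field_simps power2_eq_square)
      then show ?thesis
        using kpos[of t] by simp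
    qed
    have "integral ?I (\<lambda>t. k t + 1 / k t - 2) = integral ?I k + integral ?I (\<lambda>t. 1 / k t) - 4 * pi"
      using contk contk'
      by (simp add: integral_diff integral_add integrable_add integrable_continuous_real)
    also have "\<dots> \<le> 0"
      using k1 k2 by simp
    finally have "integral ?I (\<lambda>t. k t + 1 / k t - 2) \<le> 0" .
    moreover have cont: "continuous_on ?I (\<lambda>t. k t + 1 / k t - 2)"
      by (intro continuous_intros contk contk')
    then have "0 \<le> integral ?I (\<lambda>t. k t + 1 / k t - 2)"
      using nonneg by (intro integral_nonneg integrable_continuous_real) auto
    ultimately have "integral ?I (\<lambda>t. k t + 1 / k t - 2) = 0"
      by simp
    then have zero: "k t + 1 / k t - 2 = 0" if "t \<in> ?I" for t
      using integral_eq_0_iff[OF cont] nonneg that by simp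
    have "k t = 1" if "t \<in> ?I" for t
    proof -
      have "(k t - 1)\<^sup>2 = 0"
        using zero[OF that] kpos[of t] by (simp add: field_simps power2_eq_square)
      then show ?thesis by simp
    qed
    moreover have "z = of_real s * cis (Arg2pi z)"
      using Arg2pi_eq[of z] by (simp add: s_def cis_conv_exp)
    moreover have "Arg2pi z \<in> ?I"
      using Arg2pi[of z] by auto
    ultimately show ?thesis
      by (metis k_def)
  qed
  define z0 :: complex where "z0 = of_real ((r0 + 1) / 2)"
  have z0: "z0 \<in> annulus r0"
    using r0 by (simp add: z0_def annulus_def)
  have "connected (annulus r0)"
    using connected_annulus(1)[of r0 "0::complex" 1] by (simp add: annulus_def)
  then have "h constant_on annulus r0"
    using maximum_modulus_principle[OF h open_annulus _ open_annulus order_refl z0] norm1 z0 by simp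
  then show ?thesis
    using norm1 z0 by (metis constant_on_def)
qed

text \<open>
  The comparison map \<open>g\<close> will be \<open>z\<close> or \<open>r0 / z\<close>: the quotient \<open>\<phi> / g\<close> has no zeros and is bounded
  above and below, since \<open>\<phi>\<close> and \<open>g\<close> both take values of modulus between \<open>r0\<close> and \<open>1\<close>.
\<close>

lemma self_map_eq_of_boundary_modulus:
  assumes r0: "0 < r0" "r0 < 1"
    and \<phi>: "\<phi> holomorphic_on annulus r0" "\<phi> ` annulus r0 \<subseteq> annulus r0"
    and g: "g holomorphic_on annulus r0" "continuous_on {z. r0 \<le> cmod z \<and> cmod z \<le> 1} g"
    and g_bounds: "\<And>z. r0 \<le> cmod z \<Longrightarrow> cmod z \<le> 1 \<Longrightarrow> r0 \<le> cmod (g z) \<and> cmod (g z) \<le> 1"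
    and bdry: "\<And>r. r = r0 \<or> r = 1 \<Longrightarrow> AE t in lebesgue_on {0..2*pi}.
      cmod (boundary_trace (annulus r0) \<phi> (of_real r * cis t)) = cmod (g (of_real r * cis t))"
  shows "\<exists>c. cmod c = 1 \<and> (\<forall>z\<in>annulus r0. \<phi> z = c * g z)"
proof -
  have g0: "g z \<noteq> 0" if "r0 \<le> cmod z" "cmod z \<le> 1" for z
    using g_bounds[OF that] r0 by auto
  have "\<exists>c. cmod c = 1 \<and> (\<forall>z\<in>annulus r0. \<phi> z / g z = c)"
  proof (rule unimodular_constant_of_radial_limits[where a = r0 and b = "1 / r0"])
    show "(\<lambda>z. \<phi> z / g z) holomorphic_on annulus r0"
      using g0 by (intro holomorphic_intros \<phi> g) (auto simp: annulus_def)
  next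
    fix z assume z: "z \<in> annulus r0"
    then have z': "r0 \<le> cmod z" "cmod z \<le> 1" "z \<in> annulus r0"
      by (auto simp: annulus_def)
    then have "r0 \<le> cmod (\<phi> z)" "cmod (\<phi> z) \<le> 1"
      using \<phi>(2) by (auto simp: annulus_def image_subset_iff less_imp_le)
    moreover note g_bounds[OF z'(1,2)]
    ultimately have "r0 / 1 \<le> cmod (\<phi> z) / cmod (g z)" "cmod (\<phi> z) / cmod (g z) \<le> 1 / r0"
      using r0 by (auto intro!: frac_le simp del: div_by_1)
    then show "r0 \<le> cmod (\<phi> z / g z)" "cmod (\<phi> z / g z) \<le> 1 / r0"
      by (simp_all add: norm_divide)
  next
    fix X :: "nat \<Rightarrow> real" and r
    assume r: "r = r0 \<or> r = 1" and X: "X \<longlonglongrightarrow> r" "\<And>n. r0 < X n" "\<And>n. X n < 1"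
    from bdry[OF r]
    show "AE t in lebesgue_on {0..2*pi}. (\<lambda>n. cmod (\<phi> (of_real (X n) * cis t) / g (of_real (X n) * cis t))) \<longlonglongrightarrow> 1"
    proof eventually_elim
      case (elim t)
      let ?\<zeta> = "of_real r * cis t"
      have n\<zeta>: "r0 \<le> cmod ?\<zeta>" "cmod ?\<zeta> \<le> 1"
        using r r0 by (auto simp: norm_mult)
      have "boundary_trace (annulus r0) \<phi> ?\<zeta> \<noteq> 0"
        using elim g0[OF n\<zeta>] by auto
      then have "(\<lambda>n. \<phi> (of_real (X n) * cis t)) \<longlonglongrightarrow> boundary_trace (annulus r0) \<phi> ?\<zeta>"
        by (intro boundary_trace_radial r0 r X) auto
      moreover have "(\<lambda>n. g (of_real (X n) * cis t)) \<longlonglongrightarrow> g ?\<zeta>"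
      proof (rule continuous_on_tendsto_compose[OF g(2)])
        show "(\<lambda>n. of_real (X n) * cis t) \<longlonglongrightarrow> ?\<zeta>"
          by (intro tendsto_intros X)
        have "r0 \<le> \<bar>X n\<bar> \<and> \<bar>X n\<bar> \<le> 1" for n
          using X(2)[of n] X(3)[of n] r0 by auto
        then show "\<forall>\<^sub>F n in sequentially. of_real (X n) * cis t \<in> {z. r0 \<le> cmod z \<and> cmod z \<le> 1}"
          by (simp add: norm_mult)
      qed (use n\<zeta> in auto)
      ultimately have "(\<lambda>n. cmod (\<phi> (of_real (X n) * cis t) / g (of_real (X n) * cis t)))
          \<longlonglongrightarrow> cmod (boundary_trace (annulus r0) \<phi> ?\<zeta> / g ?\<zeta>)"
        using g0[OF n\<zeta>] by (intro tendsto_intros)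
      then show ?case
        using elim g0[OF n\<zeta>] by (simp add: norm_divide)
    qed
  qed (use r0 in auto)
  then obtain c where "cmod c = 1" "\<And>z. z \<in> annulus r0 \<Longrightarrow> \<phi> z / g z = c"
    by auto
  then show ?thesis
    using g0 by (intro exI[of _ c]) (auto simp: annulus_def divide_eq_eq)
qed


section \<open>Rotations and inversions induce isometries\<close>

lemma boundary_bilipschitz_rotation:
  assumes "0 < r0" "r0 < 1" and c: "cmod c = 1"
  shows "boundary_bilipschitz (annulus r0) (\<lambda>z. c * z)"
  unfolding boundary_bilipschitz_def
proof (intro conjI exI[of _ 1] ballI)
  show "(*) c ` annulus r0 \<subseteq> annulus r0"
    using c by (auto simp: annulus_def norm_mult)
  show "(*) c ` frontier (annulus r0) = frontier (annulus r0)"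
  proof
    show "(*) c ` frontier (annulus r0) \<subseteq> frontier (annulus r0)"
      using c unfolding frontier_annulus[OF assms(1,2)] by (auto simp: norm_mult)
    show "frontier (annulus r0) \<subseteq> (*) c ` frontier (annulus r0)"
    proof
      fix \<eta> assume "\<eta> \<in> frontier (annulus r0)"
      moreover have "\<eta> = c * (\<eta> / c)" "cmod (\<eta> / c) = cmod \<eta>"
        using c by (auto simp: norm_divide)
      ultimately show "\<eta> \<in> (*) c ` frontier (annulus r0)"
        unfolding frontier_annulus[OF assms(1,2)] by (intro image_eqI[of _ _ "\<eta> / c"]) auto
    qed
  qed
  fix z \<eta>
  have "dist (c * z) (c * \<eta>) = dist z \<eta>"
    using c by (simp add: dist_norm norm_mult flip: right_diff_distrib)
  then show "dist (c * z) (c * \<eta>) \<le> 1 * dist z \<eta>" "dist z \<eta> \<le> 1 * dist (c * z) (c * \<eta>)"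
    by simp_all
qed simp

lemma inverted_radius_bounds:
  fixes r0 r :: real
  assumes "0 < r0" "r0 < r" "r < 1"
  shows "r0 < r0 / r" "r0 / r < 1"
  using assms by (simp_all add: less_divide_eq)

text \<open>
  The factor by which \<open>c r0 / z\<close> changes the distance of \<open>z\<close> and \<open>\<eta>\<close> is \<open>r0 / (|z| |\<eta>|)\<close>, which lies
  between \<open>r0\<close> and \<open>1 / r0\<close> on the closed annulus.
\<close>

lemma boundary_bilipschitz_inversion:
  assumes r0: "0 < r0" "r0 < 1" and c: "cmod c = 1"
  shows "boundary_bilipschitz (annulus r0) (\<lambda>z. c * (of_real r0 / z))"
proof -
  define \<psi> where "\<psi> z = c * (of_real r0 / z)" for z
  have norm: "cmod (\<psi> z) = r0 / cmod z" for z
    using c r0 by (simp add: \<psi>_def norm_mult norm_divide)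
  have inv: "\<psi> (\<psi> z) = z" if "z \<noteq> 0" for z
    using that c r0 by (auto simp: \<psi>_def)
  have fr: "\<psi> \<eta> \<in> frontier (annulus r0)" if "\<eta> \<in> frontier (annulus r0)" for \<eta>
    using that r0 unfolding frontier_annulus[OF r0] by (auto simp: norm)
  have "\<psi> ` annulus r0 \<subseteq> annulus r0"
    using inverted_radius_bounds[OF r0(1)] by (auto simp: annulus_def norm)
  moreover have "\<psi> ` frontier (annulus r0) = frontier (annulus r0)"
  proof -
    have "\<eta> \<noteq> 0" if "\<eta> \<in> frontier (annulus r0)" for \<eta>
      using that r0 unfolding frontier_annulus[OF r0] by auto
    then have "\<eta> \<in> \<psi> ` frontier (annulus r0)" if "\<eta> \<in> frontier (annulus r0)" for \<eta>
      using that fr inv by (intro image_eqI[of _ _ "\<psi> \<eta>"]) auto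
    then show ?thesis
      using fr by blast
  qed
  moreover have "dist (\<psi> z) (\<psi> \<eta>) \<le> 1 / r0 * dist z \<eta> \<and> dist z \<eta> \<le> 1 / r0 * dist (\<psi> z) (\<psi> \<eta>)"
    if z: "z \<in> annulus r0" and \<eta>: "\<eta> \<in> frontier (annulus r0)" for z \<eta>
  proof -
    have b: "r0 \<le> cmod z" "cmod z \<le> 1" "r0 \<le> cmod \<eta>" "cmod \<eta> \<le> 1"
      using z \<eta> r0 unfolding frontier_annulus[OF r0] by (auto simp: annulus_def)
    then have nz: "z \<noteq> 0" "\<eta> \<noteq> 0"
      using r0 by auto
    have "\<psi> z - \<psi> \<eta> = c * of_real r0 * (\<eta> - z) / (z * \<eta>)"
      using nz by (simp add: \<psi>_def field_simps)
    then have d: "dist (\<psi> z) (\<psi> \<eta>) = r0 * dist z \<eta> / (cmod z * cmod \<eta>)"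
      using c r0 by (simp add: dist_norm norm_mult norm_divide norm_minus_commute)
    have "r0 * r0 \<le> cmod z * cmod \<eta>" "cmod z * cmod \<eta> \<le> 1"
      using b r0 by (auto intro!: mult_mono mult_le_one)
    moreover have "0 \<le> r0 * dist z \<eta>" "0 < cmod z * cmod \<eta>" "0 < r0 * r0"
      using r0 nz by auto
    ultimately have "r0 * dist z \<eta> / (cmod z * cmod \<eta>) \<le> r0 * dist z \<eta> / (r0 * r0)"
      "r0 * dist z \<eta> / 1 \<le> r0 * dist z \<eta> / (cmod z * cmod \<eta>)"
      by (metis divide_left_mono mult_pos_pos zero_less_one mult_1)+
    then have "dist (\<psi> z) (\<psi> \<eta>) \<le> r0 * dist z \<eta> / (r0 * r0)" "r0 * dist z \<eta> \<le> dist (\<psi> z) (\<psi> \<eta>)"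
      unfolding d by simp_all
    then show ?thesis
      using r0 by (simp add: field_simps)
  qed
  ultimately have "boundary_bilipschitz (annulus r0) \<psi>"
    using r0 unfolding boundary_bilipschitz_def by (intro conjI exI[of _ "1 / r0"]) auto
  then show ?thesis
    by (simp add: \<psi>_def[abs_def])
qed

text \<open>
  What rotations and inversions have in common: the boundary trace of \<open>f \<circ> \<phi>\<close> is the trace of \<open>f\<close>
  composed with \<open>\<psi>\<close>, and \<open>\<psi>\<close> carries the mean over the circle of radius \<open>r\<close> to the mean over the
  circle of radius \<open>\<sigma> r\<close>. As \<open>\<sigma>\<close> fixes or exchanges the two boundary radii, the norm is preserved.
  The map \<open>\<psi>\<close> is separate from \<open>\<phi>\<close> because \<open>\<phi>\<close> is prescribed only on the open annulus, whereas
  the boundary values of \<open>\<psi>\<close> are used.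
\<close>

lemma hardy_isometry_composition_operator:
  assumes r0: "0 < r0" "r0 < 1"
    and \<phi>: "\<phi> holomorphic_on annulus r0" "\<phi> ` annulus r0 \<subseteq> annulus r0"
    and eq: "\<And>z. z \<in> annulus r0 \<Longrightarrow> \<phi> z = \<psi> z"
    and \<psi>: "boundary_bilipschitz (annulus r0) \<psi>" and \<psi>': "boundary_bilipschitz (annulus r0) \<psi>'"
    and inv: "\<And>z. z \<noteq> 0 \<Longrightarrow> \<psi>' (\<psi> z) = z" "\<And>z. z \<noteq> 0 \<Longrightarrow> \<psi> (\<psi>' z) = z"
    and mean: "\<And>g r. (\<And>z. 0 \<le> g z) \<Longrightarrow> r0 \<le> r \<Longrightarrow> r \<le> 1 \<Longrightarrow>
      circle_mean r (\<lambda>z. g (\<psi> z)) = circle_mean (\<sigma> r) g"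
    and \<sigma>: "\<And>r. r0 < r \<Longrightarrow> r < 1 \<Longrightarrow> r0 < \<sigma> r \<and> \<sigma> r < 1"
      "\<sigma> 1 = 1 \<and> \<sigma> r0 = r0 \<or> \<sigma> 1 = r0 \<and> \<sigma> r0 = 1"
  shows "hardy_isometry p r0 (composition_operator \<phi>)"
proof -
  have nz: "z \<noteq> 0" if "z \<in> annulus r0 \<union> frontier (annulus r0)" for z
    using that r0 unfolding frontier_annulus[OF r0] by (auto simp: annulus_def)
  have space: "f \<circ> \<phi> \<in> hardy_space p r0" if f: "f \<in> hardy_space p r0" for f
  proof -
    let ?g = "\<lambda>z. cmod (f z) powr p"
    have hol: "f holomorphic_on annulus r0" and bdd: "bdd_above ((\<lambda>r. circle_mean r ?g) ` {r0<..<1})"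
      using f by (auto simp: hardy_space_def)
    have "circle_mean r (\<lambda>z. cmod ((f \<circ> \<phi>) z) powr p) = circle_mean (\<sigma> r) ?g" 
      if r: "r \<in> {r0<..<1}" for r
    proof -
      have "circle_mean r (\<lambda>z. cmod ((f \<circ> \<phi>) z) powr p) = circle_mean r (\<lambda>z. ?g (\<psi> z))"
        using r r0 eq by (intro circle_mean_cong) (auto simp: annulus_def)
      also have "\<dots> = circle_mean (\<sigma> r) ?g"
        using r by (intro mean) auto
      finally show ?thesis .
    qed
    then have "(\<lambda>r. circle_mean r (\<lambda>z. cmod ((f \<circ> \<phi>) z) powr p)) ` {r0<..<1}
        \<subseteq> (\<lambda>r. circle_mean r ?g) ` {r0<..<1}"
      using \<sigma>(1) by auto
    then have "bdd_above ((\<lambda>r. circle_mean r (\<lambda>z. cmod ((f \<circ> \<phi>) z) powr p)) ` {r0<..<1})"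
      using bdd by (rule bdd_above_mono[rotated])
    moreover have "f \<circ> \<phi> holomorphic_on annulus r0"
      using holomorphic_on_compose_gen[OF \<phi>(1) hol \<phi>(2)] .
    ultimately show ?thesis
      by (simp add: hardy_space_def)
  qed
  have norm: "hardy_norm p r0 (f \<circ> \<phi>) = hardy_norm p r0 f" for f
  proof -
    let ?g = "\<lambda>\<zeta>. cmod (boundary_trace (annulus r0) f \<zeta>) powr p"
    have "circle_mean r (\<lambda>\<zeta>. cmod (boundary_trace (annulus r0) (f \<circ> \<phi>) \<zeta>) powr p)
        = circle_mean (\<sigma> r) ?g" if r: "r = r0 \<or> r = 1" for r
    proof -
      have "boundary_trace (annulus r0) (f \<circ> \<phi>) \<zeta> = boundary_trace (annulus r0) f (\<psi> \<zeta>)"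
        if "cmod \<zeta> = \<bar>r\<bar>" for \<zeta>
      proof -
        have "boundary_trace (annulus r0) (f \<circ> \<phi>) \<zeta> = boundary_trace (annulus r0) (f \<circ> \<psi>) \<zeta>"
          by (rule boundary_trace_cong) (simp add: eq)
        also have "\<dots> = boundary_trace (annulus r0) f (\<psi> \<zeta>)"
          using that r r0 inv nz
          by (intro boundary_trace_compose[OF \<psi> \<psi>']) (auto simp: frontier_annulus)
        finally show ?thesis .
      qed
      then have "circle_mean r (\<lambda>\<zeta>. cmod (boundary_trace (annulus r0) (f \<circ> \<phi>) \<zeta>) powr p)
          = circle_mean r (\<lambda>\<zeta>. ?g (\<psi> \<zeta>))"
        by (intro circle_mean_cong) simp
      also have "\<dots> = circle_mean (\<sigma> r) ?g"
        using r r0 by (intro mean) auto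
      finally show ?thesis .
    qed
    then show ?thesis
      using \<sigma>(2) by (auto simp: hardy_norm_def add.commute)
  qed
  show ?thesis
    using space norm by (simp add: hardy_isometry_def composition_operator_def)
qed

lemma hardy_isometry_rotation:
  assumes r0: "0 < r0" "r0 < 1"
    and \<phi>: "\<phi> holomorphic_on annulus r0" "\<phi> ` annulus r0 \<subseteq> annulus r0"
    and c: "cmod c = 1" and eq: "\<And>z. z \<in> annulus r0 \<Longrightarrow> \<phi> z = c * z"
  shows "hardy_isometry p r0 (composition_operator \<phi>)"
proof (rule hardy_isometry_composition_operator[where \<sigma> = "\<lambda>r. r" and \<psi>' = "\<lambda>z. cnj c * z", OF r0 \<phi> eq])
  have "cnj c * c = 1"
    using c complex_norm_square[of c] by (simp add: mult.commute)
  then show "cnj c * (c * z) = z" "c * (cnj c * z) = z" for z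
    by (simp_all add: mult.assoc[symmetric] mult.commute)
  show "boundary_bilipschitz (annulus r0) (\<lambda>z. c * z)" "boundary_bilipschitz (annulus r0) (\<lambda>z. cnj c * z)"
    using r0 c by (auto intro!: boundary_bilipschitz_rotation)
qed (use c circle_mean_rotate in auto)

lemma hardy_isometry_inversion:
  assumes r0: "0 < r0" "r0 < 1"
    and \<phi>: "\<phi> holomorphic_on annulus r0" "\<phi> ` annulus r0 \<subseteq> annulus r0"
    and c: "cmod c = 1" and eq: "\<And>z. z \<in> annulus r0 \<Longrightarrow> \<phi> z = c * (of_real r0 / z)"
  shows "hardy_isometry p r0 (composition_operator \<phi>)"
proof (rule hardy_isometry_composition_operator[where \<sigma> = "\<lambda>r. r0 / r" and \<psi>' = "\<lambda>z. c * (of_real r0 / z)", OF r0 \<phi> eq])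
  show "boundary_bilipschitz (annulus r0) (\<lambda>z. c * (of_real r0 / z))"
    using r0 c by (rule boundary_bilipschitz_inversion)
  then show "boundary_bilipschitz (annulus r0) (\<lambda>z. c * (of_real r0 / z))" .
  have "c \<noteq> 0"
    using c by auto
  then show "c * (of_real r0 / (c * (of_real r0 / z))) = z" if "z \<noteq> 0" for z
    using that r0 by simp
  then show "c * (of_real r0 / (c * (of_real r0 / z))) = z" if "z \<noteq> 0" for z
    using that by simp
  show "circle_mean r (\<lambda>z. g (c * (of_real r0 / z))) = circle_mean (r0 / r) g"
    if "\<And>z. 0 \<le> g z" "r0 \<le> r" for g r
    using that r0 c by (intro circle_mean_inversion) auto
qed (use r0 inverted_radius_bounds in auto)

theorem theorem7:
  fixes p r0 :: real and \<phi> :: "complex \<Rightarrow> complex"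
  assumes "1 < p" and "0 < r0" and "r0 < 1"
    and "\<phi> holomorphic_on annulus r0"
    and "\<phi> ` annulus r0 \<subseteq> annulus r0"
  shows
    "((AE t in lebesgue_on {0..2 * pi}.
          cmod (boundary_trace (annulus r0) \<phi> (of_real r0 * cis t)) = r0) \<and>
      (AE t in lebesgue_on {0..2 * pi}.
          cmod (boundary_trace (annulus r0) \<phi> (cis t)) = 1)
      \<longrightarrow> (hardy_isometry p r0 (composition_operator \<phi>) \<longleftrightarrow>
           (\<exists>c. cmod c = 1 \<and> (\<forall>z\<in>annulus r0. \<phi> z = c * z))))
     \<and>
     ((AE t in lebesgue_on {0..2 * pi}.
          cmod (boundary_trace (annulus r0) \<phi> (of_real r0 * cis t)) = 1) \<and>
      (AE t in lebesgue_on {0..2 * pi}.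
          cmod (boundary_trace (annulus r0) \<phi> (cis t)) = r0)
      \<longrightarrow> (hardy_isometry p r0 (composition_operator \<phi>) \<longleftrightarrow>
           (\<exists>c. cmod c = 1 \<and> (\<forall>z\<in>annulus r0. \<phi> z = c * (of_real r0 / z)))))"
proof (intro conjI impI; elim conjE)
  note r0 = assms(2,3) and \<phi> = assms(4,5)
  assume inner: "AE t in lebesgue_on {0..2 * pi}.
      cmod (boundary_trace (annulus r0) \<phi> (of_real r0 * cis t)) = r0"
    and outer: "AE t in lebesgue_on {0..2 * pi}. cmod (boundary_trace (annulus r0) \<phi> (cis t)) = 1"
  have "\<exists>c. cmod c = 1 \<and> (\<forall>z\<in>annulus r0. \<phi> z = c * z)"
  proof (rule self_map_eq_of_boundary_modulus[OF r0 \<phi>])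
    fix r assume "r = r0 \<or> r = 1"
    then show "AE t in lebesgue_on {0..2*pi}.
        cmod (boundary_trace (annulus r0) \<phi> (of_real r * cis t)) = cmod (of_real r * cis t)"
      using inner outer r0 by (auto simp: norm_mult)
  qed (auto intro!: holomorphic_intros continuous_intros)
  then show "hardy_isometry p r0 (composition_operator \<phi>) \<longleftrightarrow>
      (\<exists>c. cmod c = 1 \<and> (\<forall>z\<in>annulus r0. \<phi> z = c * z))"
    using hardy_isometry_rotation[OF r0 \<phi>] by blast
next
  note r0 = assms(2,3) and \<phi> = assms(4,5)
  assume inner: "AE t in lebesgue_on {0..2 * pi}.
      cmod (boundary_trace (annulus r0) \<phi> (of_real r0 * cis t)) = 1"
    and outer: "AE t in lebesgue_on {0..2 * pi}. cmod (boundary_trace (annulus r0) \<phi> (cis t)) = r0"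
  have nz: "z \<noteq> 0" if "r0 \<le> cmod z" for z
    using that r0 by auto
  have "\<exists>c. cmod c = 1 \<and> (\<forall>z\<in>annulus r0. \<phi> z = c * (of_real r0 / z))"
  proof (rule self_map_eq_of_boundary_modulus[OF r0 \<phi>])
    show "(\<lambda>z. of_real r0 / z) holomorphic_on annulus r0"
      using nz by (intro holomorphic_intros) (auto simp: annulus_def)
    show "continuous_on {z. r0 \<le> cmod z \<and> cmod z \<le> 1} (\<lambda>z. complex_of_real r0 / z)"
      using nz by (intro continuous_intros) auto
    show "r0 \<le> cmod (of_real r0 / z) \<and> cmod (of_real r0 / z) \<le> 1"
      if "r0 \<le> cmod z" "cmod z \<le> 1" for z
      using that r0 nz by (simp add: norm_divide divide_simps mult_left_le)
    fix r assume "r = r0 \<or> r = 1"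
    then show "AE t in lebesgue_on {0..2*pi}.
        cmod (boundary_trace (annulus r0) \<phi> (of_real r * cis t)) = cmod (of_real r0 / (of_real r * cis t))"
      using inner outer r0 by (auto simp: norm_mult norm_divide)
  qed
  then show "hardy_isometry p r0 (composition_operator \<phi>) \<longleftrightarrow>
      (\<exists>c. cmod c = 1 \<and> (\<forall>z\<in>annulus r0. \<phi> z = c * (of_real r0 / z)))"
    using hardy_isometry_inversion[OF r0 \<phi>] by blast
qed

end
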